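(* (A) Let $N$ be an almost perfect cover of a restriction semigroup $S$, via the $P$-separating surjective homomorphism $\beta:N\to S$. Put $T=N/\sigma$ and $\alpha=\kappa\hat\beta:T\to C(S)$, that is, $t\alpha=\{n\beta: n\in t\}$ for each $\sigma$-class $t$ of $N$. Then $N\cong S_{T,C(S)}=\{(a,t)\in S\times T: a\in t\alpha\}$, and $S\subseteq(T\alpha)\!\downarrow$, that is, every $s\in S$ belongs to $t\alpha$ for some $t\in T$. (B) Let $N$ be a perfect, monoidal cover of a restriction monoid $M$, via the $P$-separating surjective monoidal homomorphism $\beta:N\to M$. Put $T=N/\sigma$ and $\alpha=\kappa\beta:T\to M$, that is, $(a\sigma)\alpha=m_a\beta$, where $m_a$ is the greatest element of $a\sigma$. Then $N\cong M_T=\{(a,t)\in M\times T: a\le t\alpha\}$, and $T\alpha$ $P$-generates $M$.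
   Context: A restriction semigroup is an algebra $(S,\cdot,{}^+,{}^* )$ with $(S,\cdot)$ a semigroup, satisfying $x^+x=x$, $(x^+y)^+=x^+y^+$, $x^+y^+=y^+x^+$, $xy^+=(xy)^+x$, the dual identities $xx^*=x$, $(yx^* )^*=y^*x^*$, $y^*x^*=x^*y^*$, $y^*x=x(yx)^*$, and $(x^+)^*=x^+$, $(x^* )^+=x^*$. Its projections form the semilattice $P_S=\{x^+:x\in S\}=\{x^*:x\in S\}$. A restriction monoid is a restriction semigroup with identity $1$ (so $1^+=1^*=1$). A plain monoid is regarded as a restriction monoid by setting $a^+=a^*=1$ for all $a$. The natural partial order is $a\le b$ iff $a=eb$ for some $e\in P_S$; order ideals are nonempty downward-closed subsets. Relations on $S$: $a\mathrel{\mathbb R}b$ iff $a^+=b^+$; $a\mathrel{\mathbb L}b$ iff $a^*=b^*$; $\sigma=\{(a,b): ea=eb\text{ for some }e\in P_S\}$ is the least congruence identifying all projections. $S$ is proper if $\mathbb R\cap\sigma$ and $\mathbb L\cap\sigma$ are both the identity relation. $\sigma$ is perfect if $(a\sigma)(b\sigma)=(ab)\sigma$ for all $a,b$ (product of subsets). $S$ is almost perfect if it is proper and $\sigma$ is perfect. A restriction monoid is perfect if moreover every $\sigma$-class has a greatest element. A homomorphism (respecting all three operations; 'monoidal' if also identity-preserving) is $P$-separating if it is injective on projections. A cover of $U$ is a proper restriction semigroup having $U$ as the image of a $P$-separating homomorphism. A plain submonoid $T'$ of a restriction monoid $M$ $P$-generates $M$ if $M=P_MT'$. A permissible subset of $S$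 is an order ideal $A$ with $a^+b=b^+a$ and $ab^*=ba^*$ for all $a,b\in A$; the set $C(S)$ of permissible subsets is a restriction monoid under multiplication of subsets, with $A^+=\{a^+:a\in A\}$, $A^*=\{a^*:a\in A\}$, identity $P_S$, and natural partial order equal to inclusion. $S$ is identified with its image in $C(S)$ under $\tau_S: a\mapsto\{b:b\le a\}$, so $a\le A$ in $C(S)$ means $a\in A$. When $N$ is proper its $\sigma$-classes are permissible, and in (A) $\kappa:T=N/\sigma\to C(N)$ is the inclusion of the set of $\sigma$-classes; $\hat\beta:C(N)\to C(S)$ is $A\mapsto A\beta$. In (B) $\kappa:T\to N$ is $a\sigma\mapsto m_a$. The sets $S_{T,C(S)}$ and $M_T$ are regarded as restriction subsemigroups of $S\times T$ and $M\times T$ respectively. *)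

theory Defs
  imports "HOL-Algebra.Coset"
begin

text \<open>
  Restriction semigroups are carrier-based records on top of the library's monoids. Notions that
  concern restriction semigroups never refer to the field \<open>one\<close>, so for a restriction semigroup
  without identity its value is irrelevant.
\<close>

record 'a restr = "'a monoid" +
  rplus :: "'a \<Rightarrow> 'a" (\<open>_\<^bold>+\<index>\<close> [90] 90)
  rstar :: "'a \<Rightarrow> 'a" (\<open>_\<^bold>*\<index>\<close> [90] 90)

locale restriction_semigroup =
  fixes S (structure)
  assumes nonempty: "carrier S \<noteq> {}"
    and mult_closed: "\<lbrakk>x \<in> carrier S; y \<in> carrier S\<rbrakk> \<Longrightarrow> x \<otimes> y \<in> carrier S"
    and plus_closed: "x \<in> carrier S \<Longrightarrow> x\<^bold>+ \<in> carrier S"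
    and star_closed: "x \<in> carrier S \<Longrightarrow> x\<^bold>* \<in> carrier S"
    and assoc: "\<lbrakk>x \<in> carrier S; y \<in> carrier S; z \<in> carrier S\<rbrakk> \<Longrightarrow> (x \<otimes> y) \<otimes> z = x \<otimes> (y \<otimes> z)"
    and plus_left: "x \<in> carrier S \<Longrightarrow> x\<^bold>+ \<otimes> x = x"
    and plus_mult: "\<lbrakk>x \<in> carrier S; y \<in> carrier S\<rbrakk> \<Longrightarrow> (x\<^bold>+ \<otimes> y)\<^bold>+ = x\<^bold>+ \<otimes> y\<^bold>+"
    and plus_comm: "\<lbrakk>x \<in> carrier S; y \<in> carrier S\<rbrakk> \<Longrightarrow> x\<^bold>+ \<otimes> y\<^bold>+ = y\<^bold>+ \<otimes> x\<^bold>+"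
    and plus_ample: "\<lbrakk>x \<in> carrier S; y \<in> carrier S\<rbrakk> \<Longrightarrow> x \<otimes> y\<^bold>+ = (x \<otimes> y)\<^bold>+ \<otimes> x"
    and star_right: "x \<in> carrier S \<Longrightarrow> x \<otimes> x\<^bold>* = x"
    and star_mult: "\<lbrakk>x \<in> carrier S; y \<in> carrier S\<rbrakk> \<Longrightarrow> (y \<otimes> x\<^bold>*)\<^bold>* = y\<^bold>* \<otimes> x\<^bold>*"
    and star_comm: "\<lbrakk>x \<in> carrier S; y \<in> carrier S\<rbrakk> \<Longrightarrow> y\<^bold>* \<otimes> x\<^bold>* = x\<^bold>* \<otimes> y\<^bold>*"
    and star_ample: "\<lbrakk>x \<in> carrier S; y \<in> carrier S\<rbrakk> \<Longrightarrow> y\<^bold>* \<otimes> x = x \<otimes> (y \<otimes> x)\<^bold>*"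
    and plus_star: "x \<in> carrier S \<Longrightarrow> (x\<^bold>+)\<^bold>* = x\<^bold>+"
    and star_plus: "x \<in> carrier S \<Longrightarrow> (x\<^bold>*)\<^bold>+ = x\<^bold>*"

locale restriction_monoid = restriction_semigroup S + monoid S for S (structure)

definition projections :: "('a, 'x) restr_scheme \<Rightarrow> 'a set" where
  "projections S = {x\<^bold>+\<^bsub>S\<^esub> | x. x \<in> carrier S}"

definition nat_le :: "('a, 'x) restr_scheme \<Rightarrow> 'a \<Rightarrow> 'a \<Rightarrow> bool" where
  "nat_le S a b \<longleftrightarrow>
     a \<in> carrier S \<and> b \<in> carrier S \<and> (\<exists>e \<in> projections S. a = e \<otimes>\<^bsub>S\<^esub> b)"

definition order_ideal :: "('a, 'x) restr_scheme \<Rightarrow> 'a set \<Rightarrow> bool" where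
  "order_ideal S A \<longleftrightarrow>
     A \<noteq> {} \<and> A \<subseteq> carrier S \<and> (\<forall>a \<in> A. \<forall>b. nat_le S b a \<longrightarrow> b \<in> A)"

definition R_rel :: "('a, 'x) restr_scheme \<Rightarrow> ('a \<times> 'a) set" where
  "R_rel S = {(a, b). a \<in> carrier S \<and> b \<in> carrier S \<and> a\<^bold>+\<^bsub>S\<^esub> = b\<^bold>+\<^bsub>S\<^esub>}"

definition L_rel :: "('a, 'x) restr_scheme \<Rightarrow> ('a \<times> 'a) set" where
  "L_rel S = {(a, b). a \<in> carrier S \<and> b \<in> carrier S \<and> a\<^bold>*\<^bsub>S\<^esub> = b\<^bold>*\<^bsub>S\<^esub>}"

definition sigma :: "('a, 'x) restr_scheme \<Rightarrow> ('a \<times> 'a) set" where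
  "sigma S = {(a, b). a \<in> carrier S \<and> b \<in> carrier S \<and>
                      (\<exists>e \<in> projections S. e \<otimes>\<^bsub>S\<^esub> a = e \<otimes>\<^bsub>S\<^esub> b)}"

definition proper :: "('a, 'x) restr_scheme \<Rightarrow> bool" where
  "proper S \<longleftrightarrow> R_rel S \<inter> sigma S = Id_on (carrier S) \<and> L_rel S \<inter> sigma S = Id_on (carrier S)"

definition sigma_perfect :: "('a, 'x) restr_scheme \<Rightarrow> bool" where
  "sigma_perfect S \<longleftrightarrow>
     (\<forall>a \<in> carrier S. \<forall>b \<in> carrier S.
        (sigma S `` {a}) <#>\<^bsub>S\<^esub> (sigma S `` {b}) = sigma S `` {a \<otimes>\<^bsub>S\<^esub> b})"

definition almost_perfect :: "('a, 'x) restr_scheme \<Rightarrow> bool" where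
  "almost_perfect S \<longleftrightarrow> proper S \<and> sigma_perfect S"

definition is_greatest :: "('a, 'x) restr_scheme \<Rightarrow> 'a set \<Rightarrow> 'a \<Rightarrow> bool" where
  "is_greatest S A m \<longleftrightarrow> m \<in> A \<and> (\<forall>a \<in> A. nat_le S a m)"

definition perfect :: "('a, 'x) restr_scheme \<Rightarrow> bool" where
  "perfect M \<longleftrightarrow> almost_perfect M \<and> (\<forall>A \<in> carrier M // sigma M. \<exists>m. is_greatest M A m)"

definition rhom :: "('a, 'x) restr_scheme \<Rightarrow> ('b, 'y) restr_scheme \<Rightarrow> ('a \<Rightarrow> 'b) set" where
  "rhom S U = {h \<in> hom S U. \<forall>x \<in> carrier S. h (x\<^bold>+\<^bsub>S\<^esub>) = (h x)\<^bold>+\<^bsub>U\<^esub> \<and> h (x\<^bold>*\<^bsub>S\<^esub>) = (h x)\<^bold>*\<^bsub>U\<^esub>}"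

definition is_riso :: "('a, 'x) restr_scheme \<Rightarrow> ('b, 'y) restr_scheme \<Rightarrow> bool" (infixr \<open>\<cong>\<^sub>r\<close> 60) where
  "S \<cong>\<^sub>r U \<longleftrightarrow> (\<exists>h \<in> rhom S U. bij_betw h (carrier S) (carrier U))"

definition P_separating :: "('a, 'x) restr_scheme \<Rightarrow> ('a \<Rightarrow> 'b) \<Rightarrow> bool" where
  "P_separating S h \<longleftrightarrow> inj_on h (projections S)"

definition cover_via ::
    "('a, 'x) restr_scheme \<Rightarrow> ('b, 'y) restr_scheme \<Rightarrow> ('a \<Rightarrow> 'b) \<Rightarrow> bool" where
  "cover_via N U \<beta> \<longleftrightarrow>
     restriction_semigroup N \<and> proper N \<and>
     \<beta> \<in> rhom N U \<and> P_separating N \<beta> \<and> \<beta> ` carrier N = carrier U"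

definition sigma_quotient :: "('a, 'x) restr_scheme \<Rightarrow> 'a set monoid" where
  "sigma_quotient S =
     \<lparr>carrier = carrier S // sigma S,
      mult = (\<lambda>A B. \<Union>a \<in> A. \<Union>b \<in> B. sigma S `` {a \<otimes>\<^bsub>S\<^esub> b}),
      one = (\<Union>e \<in> projections S. sigma S `` {e})\<rparr>"

definition plain :: "('a, 'x) monoid_scheme \<Rightarrow> 'a restr" where
  "plain T =
     \<lparr>carrier = carrier T, mult = mult T, one = \<one>\<^bsub>T\<^esub>,
      rplus = (\<lambda>_. \<one>\<^bsub>T\<^esub>), rstar = (\<lambda>_. \<one>\<^bsub>T\<^esub>)\<rparr>"

definition rprod ::
    "('a, 'x) restr_scheme \<Rightarrow> ('b, 'y) restr_scheme \<Rightarrow> ('a \<times> 'b) restr" (infixr \<open>\<times>\<^sub>r\<close> 80) where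
  "S \<times>\<^sub>r U =
     \<lparr>carrier = carrier (S \<times>\<times> U), mult = mult (S \<times>\<times> U), one = one (S \<times>\<times> U),
      rplus = map_prod (rplus S) (rplus U), rstar = map_prod (rstar S) (rstar U)\<rparr>"

definition restriction_subsemigroup :: "'a set \<Rightarrow> ('a, 'x) restr_scheme \<Rightarrow> bool" where
  "restriction_subsemigroup H S \<longleftrightarrow>
     H \<noteq> {} \<and> H \<subseteq> carrier S \<and> (\<forall>x \<in> H. \<forall>y \<in> H. x \<otimes>\<^bsub>S\<^esub> y \<in> H) \<and>
     (\<forall>x \<in> H. x\<^bold>+\<^bsub>S\<^esub> \<in> H \<and> x\<^bold>*\<^bsub>S\<^esub> \<in> H)"

definition permissible :: "('a, 'x) restr_scheme \<Rightarrow> 'a set \<Rightarrow> bool" where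
  "permissible S A \<longleftrightarrow> order_ideal S A \<and>
     (\<forall>a \<in> A. \<forall>b \<in> A. a\<^bold>+\<^bsub>S\<^esub> \<otimes>\<^bsub>S\<^esub> b = b\<^bold>+\<^bsub>S\<^esub> \<otimes>\<^bsub>S\<^esub> a \<and> a \<otimes>\<^bsub>S\<^esub> b\<^bold>*\<^bsub>S\<^esub> = b \<otimes>\<^bsub>S\<^esub> a\<^bold>*\<^bsub>S\<^esub>)"

definition perm_monoid :: "('a, 'x) restr_scheme \<Rightarrow> 'a set restr" (\<open>\<C>\<close>) where
  "\<C> S =
     \<lparr>carrier = {A. permissible S A}, mult = set_mult S, one = projections S,
      rplus = (\<lambda>A. rplus S ` A), rstar = (\<lambda>A. rstar S ` A)\<rparr>"

text \<open>
  The inclusion of \<open>N/\<sigma>\<close> into \<open>\<C> N\<close> is the identity function on sets.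
\<close>

definition kappa_incl :: "('n, 'x) restr_scheme \<Rightarrow> 'n set \<Rightarrow> 'n set" where
  "kappa_incl N t = t"

definition hat :: "('n \<Rightarrow> 'a) \<Rightarrow> 'n set \<Rightarrow> 'a set" where
  "hat \<beta> A = \<beta> ` A"

definition kappa_max :: "('n, 'x) restr_scheme \<Rightarrow> 'n set \<Rightarrow> 'n" where
  "kappa_max N t = (THE m. is_greatest N t m)"

text \<open>
  Since \<open>S\<close> is identified with the set of its principal order ideals in \<open>\<C> S\<close>, the relation
  \<open>a \<le> t\<alpha>\<close> of \<open>\<C> S\<close> is the membership \<open>a \<in> \<alpha> t\<close>.
\<close>

definition sub_C :: "('a, 'x) restr_scheme \<Rightarrow> 't monoid \<Rightarrow> ('t \<Rightarrow> 'a set) \<Rightarrow> ('a \<times> 't) set" where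
  "sub_C S T \<alpha> = {(a, t). a \<in> carrier S \<and> t \<in> carrier T \<and> a \<in> \<alpha> t}"

definition sub_M :: "('a, 'x) restr_scheme \<Rightarrow> 't monoid \<Rightarrow> ('t \<Rightarrow> 'a) \<Rightarrow> ('a \<times> 't) set" where
  "sub_M M T \<alpha> = {(a, t). a \<in> carrier M \<and> t \<in> carrier T \<and> nat_le M a (\<alpha> t)}"

text \<open>
  A plain submonoid is a submonoid of the monoid reduct; it need not be closed under the two
  unary operations of \<open>M\<close>.
\<close>

definition P_generates :: "('a, 'x) restr_scheme \<Rightarrow> 'a set \<Rightarrow> bool" where
  "P_generates M H \<longleftrightarrow> submonoid H M \<and> carrier M = projections M <#>\<^bsub>M\<^esub> H"

end

theory Submission
  imports Defs
begin

text \<open>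
  The map \<open>n \<mapsto> (n\<beta>, n\<sigma>)\<close> is the isomorphism in both parts. If \<open>n\<beta> = m\<beta>\<close> and \<open>n \<sigma> m\<close>, then
  \<open>n\<^sup>+ = m\<^sup>+\<close> because \<open>\<beta>\<close> separates projections, and hence \<open>n = m\<close> because \<open>N\<close> is proper; its
  image is \<open>S\<^bsub>T,C(S)\<^esub>\<close> by construction. Part (B) reduces to part (A): a projection of \<open>M\<close> is the
  image of a projection of \<open>N\<close>, so that the elements below \<open>m\<^sub>a\<beta>\<close> are exactly the images of the
  elements below \<open>m\<^sub>a\<close>, that is, of the elements of \<open>a\<sigma>\<close>. Finally, perfectness of \<open>\<sigma>\<close> gives
  \<open>m\<^sub>a m\<^sub>b = m\<^sub>a\<^sub>b\<close>, so the elements \<open>m\<^sub>a\<beta>\<close> form a submonoid.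
\<close>

context restriction_semigroup
begin

lemma projections_closed: "e \<in> projections S \<Longrightarrow> e \<in> carrier S"
  by (auto simp: projections_def plus_closed)

lemma plus_in_projections: "x \<in> carrier S \<Longrightarrow> x\<^bold>+ \<in> projections S"
  by (auto simp: projections_def)

lemma star_in_projections:
  assumes "x \<in> carrier S" shows "x\<^bold>* \<in> projections S"
  using plus_in_projections[OF star_closed[OF assms]] assms by (simp add: star_plus)

lemma projection_plus:
  assumes "e \<in> projections S" shows "e\<^bold>+ = e"
proof -
  obtain x where x: "x \<in> carrier S" "e = x\<^bold>+" using assms by (auto simp: projections_def)
  have "e\<^bold>+ = ((x\<^bold>+)\<^bold>*)\<^bold>+" using x by (simp add: plus_star)
  also have "\<dots> = (x\<^bold>+)\<^bold>*" by (rule star_plus[OF plus_closed[OF x(1)]])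
  also have "\<dots> = e" using x by (simp add: plus_star)
  finally show ?thesis .
qed

lemma projection_idem: "e \<in> projections S \<Longrightarrow> e \<otimes> e = e"
  by (metis plus_left projection_plus projections_closed)

lemma projection_comm:
  "\<lbrakk>e \<in> projections S; f \<in> projections S\<rbrakk> \<Longrightarrow> e \<otimes> f = f \<otimes> e"
  by (metis plus_comm projection_plus projections_closed)

lemma projection_mult:
  "\<lbrakk>e \<in> projections S; f \<in> projections S\<rbrakk> \<Longrightarrow> e \<otimes> f \<in> projections S"
  by (metis plus_in_projections plus_mult projection_plus projections_closed mult_closed)

lemma mult_projection:
  "\<lbrakk>x \<in> carrier S; e \<in> projections S\<rbrakk> \<Longrightarrow> x \<otimes> e = (x \<otimes> e)\<^bold>+ \<otimes> x"
  by (metis plus_ample projection_plus projections_closed)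

lemma sigma_carrier: "(a, b) \<in> sigma S \<Longrightarrow> a \<in> carrier S \<and> b \<in> carrier S"
  by (simp add: sigma_def)

lemma sigmaI:
  "\<lbrakk>a \<in> carrier S; b \<in> carrier S; e \<in> projections S; e \<otimes> a = e \<otimes> b\<rbrakk> \<Longrightarrow> (a, b) \<in> sigma S"
  by (auto simp: sigma_def)

lemma equiv_sigma: "equiv (carrier S) (sigma S)"
proof (rule equivI)
  show "sigma S \<subseteq> carrier S \<times> carrier S" by (auto simp: sigma_def)
  show "refl_on (carrier S) (sigma S)"
    by (rule refl_onI) (auto intro: sigmaI plus_in_projections)
  show "sym (sigma S)" by (rule symI) (force simp: sigma_def)
  show "trans (sigma S)"
  proof (rule transI)
    fix a b c assume ab: "(a, b) \<in> sigma S" and bc: "(b, c) \<in> sigma S"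
    then obtain e f where e: "e \<in> projections S" "e \<otimes> a = e \<otimes> b"
      and f: "f \<in> projections S" "f \<otimes> b = f \<otimes> c" by (auto simp: sigma_def)
    have cl: "a \<in> carrier S" "b \<in> carrier S" "c \<in> carrier S" "e \<in> carrier S" "f \<in> carrier S"
      using ab bc e f by (auto simp: sigma_carrier projections_closed)
    have "(f \<otimes> e) \<otimes> a = (f \<otimes> e) \<otimes> b" using e cl by (simp add: assoc)
    also have "\<dots> = (e \<otimes> f) \<otimes> b" using e f by (simp add: projection_comm)
    also have "\<dots> = (e \<otimes> f) \<otimes> c" using f cl by (simp add: assoc)
    also have "\<dots> = (f \<otimes> e) \<otimes> c" using e f by (simp add: projection_comm)
    finally show "(a, c) \<in> sigma S" using cl e f by (blast intro: sigmaI projection_mult)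
  qed
qed

lemma sigma_sym: "(a, b) \<in> sigma S \<Longrightarrow> (b, a) \<in> sigma S"
  using equiv_sigma by (meson equivE symD)

lemma sigma_trans: "\<lbrakk>(a, b) \<in> sigma S; (b, c) \<in> sigma S\<rbrakk> \<Longrightarrow> (a, c) \<in> sigma S"
  using equiv_sigma by (meson equivE transD)

lemma sigma_mult_right:
  assumes "(a, b) \<in> sigma S" "c \<in> carrier S" shows "(a \<otimes> c, b \<otimes> c) \<in> sigma S"
proof -
  obtain e where e: "e \<in> projections S" "e \<otimes> a = e \<otimes> b" using assms by (auto simp: sigma_def)
  have cl: "a \<in> carrier S" "b \<in> carrier S" "e \<in> carrier S"
    using assms e by (auto simp: sigma_carrier projections_closed)
  have "e \<otimes> (a \<otimes> c) = e \<otimes> (b \<otimes> c)" using e cl assms by (simp flip: assoc)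
  then show ?thesis using cl assms e by (blast intro: sigmaI mult_closed)
qed

lemma sigma_mult_left:
  assumes "(a, b) \<in> sigma S" "c \<in> carrier S" shows "(c \<otimes> a, c \<otimes> b) \<in> sigma S"
proof -
  obtain e where e: "e \<in> projections S" "e \<otimes> a = e \<otimes> b" using assms by (auto simp: sigma_def)
  have cl: "a \<in> carrier S" "b \<in> carrier S" "e \<in> carrier S"
    using assms e by (auto simp: sigma_carrier projections_closed)
  have eq: "(c \<otimes> e)\<^bold>+ \<otimes> (c \<otimes> x) = c \<otimes> (e \<otimes> x)" if "x \<in> carrier S" for x
  proof -
    have "(c \<otimes> e)\<^bold>+ \<otimes> (c \<otimes> x) = ((c \<otimes> e)\<^bold>+ \<otimes> c) \<otimes> x"
      using that cl assms by (simp add: assoc plus_closed mult_closed)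
    also have "\<dots> = (c \<otimes> e) \<otimes> x" using mult_projection[OF assms(2) e(1)] by simp
    finally show ?thesis using that cl assms by (simp add: assoc)
  qed
  have "(c \<otimes> e)\<^bold>+ \<otimes> (c \<otimes> a) = (c \<otimes> e)\<^bold>+ \<otimes> (c \<otimes> b)" using eq cl e by simp
  then show ?thesis using cl assms
    by (blast intro: sigmaI mult_closed plus_in_projections)
qed

lemma sigma_mult:
  "\<lbrakk>(a, b) \<in> sigma S; (c, d) \<in> sigma S\<rbrakk> \<Longrightarrow> (a \<otimes> c, b \<otimes> d) \<in> sigma S"
  by (meson sigma_carrier sigma_mult_left sigma_mult_right sigma_trans)

lemma sigma_projections:
  assumes "e \<in> projections S" "f \<in> projections S" shows "(e, f) \<in> sigma S"
proof (rule sigmaI[OF _ _ projection_mult[OF assms]])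
  have cl: "e \<in> carrier S" "f \<in> carrier S" using assms by (auto simp: projections_closed)
  have "(e \<otimes> f) \<otimes> e = e \<otimes> f"
    using assms cl by (metis assoc projection_comm projection_idem)
  also have "\<dots> = (e \<otimes> f) \<otimes> f" using assms cl by (simp add: assoc projection_idem)
  finally show "(e \<otimes> f) \<otimes> e = (e \<otimes> f) \<otimes> f" .
qed (auto simp: assms projections_closed)

lemma nat_le_sigma:
  assumes "nat_le S a b" shows "(a, b) \<in> sigma S"
proof -
  obtain e where e: "e \<in> projections S" "a = e \<otimes> b" and cl: "a \<in> carrier S" "b \<in> carrier S"
    using assms by (auto simp: nat_le_def)
  have "e \<otimes> a = e \<otimes> b"
    using e cl projections_closed by (metis assoc projection_idem)
  then show ?thesis using cl e by (blast intro: sigmaI)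
qed

lemma nat_leI: "\<lbrakk>e \<in> projections S; b \<in> carrier S\<rbrakk> \<Longrightarrow> nat_le S (e \<otimes> b) b"
  by (auto simp: nat_le_def mult_closed projections_closed)

lemma nat_le_antisym:
  assumes "nat_le S a b" "nat_le S b a" shows "a = b"
proof -
  obtain e f where e: "e \<in> projections S" "a = e \<otimes> b" and f: "f \<in> projections S" "b = f \<otimes> a"
    and cl: "a \<in> carrier S" "b \<in> carrier S"
    using assms by (auto simp: nat_le_def)
  have "e \<in> carrier S" "f \<in> carrier S" using e f by (auto simp: projections_closed)
  note cl = cl this
  have ea: "e \<otimes> a = a" using e cl by (metis assoc projection_idem)
  have "a = e \<otimes> (f \<otimes> a)" using e f by simp
  also have "\<dots> = (f \<otimes> e) \<otimes> a" using e f cl by (metis assoc projection_comm)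
  also have "\<dots> = b" using ea f cl by (simp add: assoc)
  finally show ?thesis .
qed

lemma nat_le_mult:
  assumes "nat_le S a b" "nat_le S c d" shows "nat_le S (a \<otimes> c) (b \<otimes> d)"
proof -
  obtain e f where e: "e \<in> projections S" "a = e \<otimes> b" and f: "f \<in> projections S" "c = f \<otimes> d"
    and cl: "b \<in> carrier S" "d \<in> carrier S"
    using assms by (auto simp: nat_le_def)
  have "e \<in> carrier S" "f \<in> carrier S" using e f by (auto simp: projections_closed)
  note cl = cl this
  let ?g = "(b \<otimes> f)\<^bold>+"
  have g: "?g \<in> projections S" "?g \<in> carrier S"
    using cl by (auto intro: plus_in_projections mult_closed plus_closed)
  have "a \<otimes> c = e \<otimes> ((b \<otimes> f) \<otimes> d)" using e f cl by (simp add: assoc mult_closed)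
  also have "\<dots> = e \<otimes> ((?g \<otimes> b) \<otimes> d)" using mult_projection[OF cl(1) f(1)] by simp
  also have "\<dots> = (e \<otimes> ?g) \<otimes> (b \<otimes> d)" using cl g by (simp add: assoc mult_closed)
  finally show ?thesis using projection_mult[OF e(1) g(1)] cl by (simp add: nat_leI mult_closed)
qed

lemma proper_plus_eq:
  assumes "proper S" "(a, b) \<in> sigma S" "a\<^bold>+ = b\<^bold>+" shows "a = b"
proof -
  have "(a, b) \<in> R_rel S \<inter> sigma S" using assms by (auto simp: R_rel_def dest: sigma_carrier)
  then have "(a, b) \<in> Id_on (carrier S)" using assms(1) unfolding proper_def by blast
  then show ?thesis by blast
qed

lemma proper_star_eq:
  assumes "proper S" "(a, b) \<in> sigma S" "a\<^bold>* = b\<^bold>*" shows "a = b"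
proof -
  have "(a, b) \<in> L_rel S \<inter> sigma S" using assms by (auto simp: L_rel_def dest: sigma_carrier)
  then have "(a, b) \<in> Id_on (carrier S)" using assms(1) unfolding proper_def by blast
  then show ?thesis by blast
qed

lemma class_obtain:
  assumes "t \<in> carrier S // sigma S" "a \<in> t"
  shows "a \<in> carrier S" "t = sigma S `` {a}"
  using assms equiv_sigma
  by (auto simp: quotient_def dest: sigma_carrier equiv_class_eq)

lemma class_related:
  "\<lbrakk>t \<in> carrier S // sigma S; a \<in> t; b \<in> t\<rbrakk> \<Longrightarrow> (a, b) \<in> sigma S"
  by (meson equiv_sigma quotient_eq_iff)

lemma class_nonempty: "t \<in> carrier S // sigma S \<Longrightarrow> t \<noteq> {}"
  by (meson equiv_sigma in_quotient_imp_non_empty)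

lemma permissible_sigma_class:
  assumes "proper S" and t: "t \<in> carrier S // sigma S"
  shows "permissible S t"
  unfolding permissible_def order_ideal_def
proof (intro conjI ballI allI impI)
  show "t \<noteq> {}" by (rule class_nonempty[OF t])
  show "t \<subseteq> carrier S" using class_obtain[OF t] by blast
next
  fix a b assume "a \<in> t" "nat_le S b a"
  then show "b \<in> t"
    using class_obtain[OF t] nat_le_sigma sigma_sym by blast
next
  fix a b assume ab: "a \<in> t" "b \<in> t"
  have cl: "a \<in> carrier S" "b \<in> carrier S" using class_obtain[OF t] ab by auto
  have s: "(a, b) \<in> sigma S" using class_related[OF t ab] .
  show "a\<^bold>+ \<otimes> b = b\<^bold>+ \<otimes> a"
  proof (rule proper_plus_eq[OF assms(1)])
    show "(a\<^bold>+ \<otimes> b, b\<^bold>+ \<otimes> a) \<in> sigma S"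
      by (rule sigma_mult[OF sigma_projections sigma_sym[OF s]])
        (auto intro: cl plus_in_projections)
    show "(a\<^bold>+ \<otimes> b)\<^bold>+ = (b\<^bold>+ \<otimes> a)\<^bold>+" using cl by (simp add: plus_mult plus_comm)
  qed
  show "a \<otimes> b\<^bold>* = b \<otimes> a\<^bold>*"
  proof (rule proper_star_eq[OF assms(1)])
    show "(a \<otimes> b\<^bold>*, b \<otimes> a\<^bold>*) \<in> sigma S"
      by (rule sigma_mult[OF s sigma_projections]) (auto intro: cl star_in_projections)
    show "(a \<otimes> b\<^bold>*)\<^bold>* = (b \<otimes> a\<^bold>*)\<^bold>*" using cl by (simp add: star_mult star_comm)
  qed
qed

lemma sigma_quotient_mult:
  assumes "a \<in> carrier S" "b \<in> carrier S"
  shows "sigma S `` {a} \<otimes>\<^bsub>sigma_quotient S\<^esub> sigma S `` {b} = sigma S `` {a \<otimes> b}"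
proof -
  have eq: "sigma S `` {x \<otimes> y} = sigma S `` {a \<otimes> b}"
    if "x \<in> sigma S `` {a}" "y \<in> sigma S `` {b}" for x y
    using that equiv_class_eq[OF equiv_sigma sigma_mult[of a x b y]] by simp
  have ne: "sigma S `` {a} \<noteq> {}" "sigma S `` {b} \<noteq> {}"
    using assms equiv_class_self[OF equiv_sigma] by blast+
  have "(\<Union>x \<in> sigma S `` {a}. \<Union>y \<in> sigma S `` {b}. sigma S `` {x \<otimes> y}) = sigma S `` {a \<otimes> b}"
    by (rule SUP_eq_const[OF ne(1) SUP_eq_const[OF ne(2) eq]])
  then show ?thesis by (simp add: sigma_quotient_def)
qed

lemma sigma_quotient_one:
  assumes "e \<in> projections S"
  shows "\<one>\<^bsub>sigma_quotient S\<^esub> = sigma S `` {e}"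
proof -
  have "(\<Union>f \<in> projections S. sigma S `` {f}) = sigma S `` {e}"
  proof (rule SUP_eq_const)
    show "projections S \<noteq> {}" using assms by blast
    show "sigma S `` {f} = sigma S `` {e}" if "f \<in> projections S" for f
      using equiv_class_eq[OF equiv_sigma sigma_projections[OF that assms]] .
  qed
  then show ?thesis by (simp add: sigma_quotient_def)
qed

lemma carrier_sigma_quotient: "carrier (sigma_quotient S) = carrier S // sigma S"
  by (simp add: sigma_quotient_def)

lemma kappa_max_greatest:
  assumes "\<exists>m. is_greatest S t m"
  shows "is_greatest S t (kappa_max S t)"
  unfolding kappa_max_def
proof (rule theI')
  show "\<exists>!m. is_greatest S t m"
    using assms by (auto simp: is_greatest_def intro: nat_le_antisym)
qed

end

locale cover =
  N: restriction_semigroup N + S: restriction_semigroup S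
  for N :: "('n, 'x) restr_scheme" and S :: "('s, 'y) restr_scheme" +
  fixes \<beta> :: "'n \<Rightarrow> 's"
  assumes cover: "cover_via N S \<beta>"
begin

lemma proper_N: "proper N"
  using cover by (simp add: cover_via_def)

lemma inj_projections: "inj_on \<beta> (projections N)"
  using cover by (simp add: cover_via_def P_separating_def)

lemma surj: "\<beta> ` carrier N = carrier S"
  using cover by (simp add: cover_via_def)

lemma hom_closed: "n \<in> carrier N \<Longrightarrow> \<beta> n \<in> carrier S"
  using surj by auto

lemma hom_mult:
  "\<lbrakk>n \<in> carrier N; m \<in> carrier N\<rbrakk> \<Longrightarrow> \<beta> (n \<otimes>\<^bsub>N\<^esub> m) = \<beta> n \<otimes>\<^bsub>S\<^esub> \<beta> m"
  using cover by (auto simp: cover_via_def rhom_def hom_def)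

lemma hom_plus: "n \<in> carrier N \<Longrightarrow> \<beta> (n\<^bold>+\<^bsub>N\<^esub>) = (\<beta> n)\<^bold>+\<^bsub>S\<^esub>"
  using cover by (auto simp: cover_via_def rhom_def)

lemma hom_star: "n \<in> carrier N \<Longrightarrow> \<beta> (n\<^bold>*\<^bsub>N\<^esub>) = (\<beta> n)\<^bold>*\<^bsub>S\<^esub>"
  using cover by (auto simp: cover_via_def rhom_def)

lemma projections_image: "\<beta> ` projections N = projections S"
proof
  show "\<beta> ` projections N \<subseteq> projections S"
    by (auto simp: projections_def hom_plus hom_closed)
  show "projections S \<subseteq> \<beta> ` projections N"
  proof
    fix f assume "f \<in> projections S"
    then obtain n where n: "n \<in> carrier N" "f = (\<beta> n)\<^bold>+\<^bsub>S\<^esub>"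
      unfolding projections_def surj[symmetric] by auto
    then have "f = \<beta> (n\<^bold>+\<^bsub>N\<^esub>)" by (simp add: hom_plus)
    then show "f \<in> \<beta> ` projections N" using N.plus_in_projections[OF n(1)] by blast
  qed
qed

lemma hom_nat_le:
  assumes "nat_le N a b" shows "nat_le S (\<beta> a) (\<beta> b)"
proof -
  obtain e where e: "e \<in> projections N" "a = e \<otimes>\<^bsub>N\<^esub> b" and b: "b \<in> carrier N"
    using assms by (auto simp: nat_le_def)
  then have "\<beta> a = \<beta> e \<otimes>\<^bsub>S\<^esub> \<beta> b" by (simp add: hom_mult N.projections_closed)
  moreover have "\<beta> e \<in> projections S" using e projections_image by blast
  ultimately show ?thesis using b by (simp add: S.nat_leI hom_closed)
qed

lemma nat_le_lift:
  assumes "nat_le S s (\<beta> b)" "b \<in> carrier N"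
  obtains a where "nat_le N a b" "s = \<beta> a"
proof -
  obtain f where "f \<in> projections S" "s = f \<otimes>\<^bsub>S\<^esub> \<beta> b" using assms by (auto simp: nat_le_def)
  then obtain e where e: "e \<in> projections N" "s = \<beta> e \<otimes>\<^bsub>S\<^esub> \<beta> b"
    unfolding projections_image[symmetric] by auto
  show thesis
  proof (rule that)
    show "nat_le N (e \<otimes>\<^bsub>N\<^esub> b) b" by (rule N.nat_leI[OF e(1) assms(2)])
    show "s = \<beta> (e \<otimes>\<^bsub>N\<^esub> b)" using e assms by (simp add: hom_mult N.projections_closed)
  qed
qed

lemma permissible_image:
  assumes "permissible N A" shows "permissible S (\<beta> ` A)"
  unfolding permissible_def order_ideal_def
proof (intro conjI ballI allI impI)
  have A: "A \<noteq> {}" "A \<subseteq> carrier N" and down: "\<And>a b. a \<in> A \<Longrightarrow> nat_le N b a \<Longrightarrow> b \<in> A"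
    and comp: "\<And>a b. a \<in> A \<Longrightarrow> b \<in> A \<Longrightarrow> a\<^bold>+\<^bsub>N\<^esub> \<otimes>\<^bsub>N\<^esub> b = b\<^bold>+\<^bsub>N\<^esub> \<otimes>\<^bsub>N\<^esub> a"
      "\<And>a b. a \<in> A \<Longrightarrow> b \<in> A \<Longrightarrow> a \<otimes>\<^bsub>N\<^esub> b\<^bold>*\<^bsub>N\<^esub> = b \<otimes>\<^bsub>N\<^esub> a\<^bold>*\<^bsub>N\<^esub>"
    using assms by (auto simp: permissible_def order_ideal_def)
  show "\<beta> ` A \<noteq> {}" using A by simp
  show "\<beta> ` A \<subseteq> carrier S" using A hom_closed by auto
  show "s \<in> \<beta> ` A" if "r \<in> \<beta> ` A" "nat_le S s r" for r s
    using that A down by (auto elim!: nat_le_lift)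
  fix r s assume "r \<in> \<beta> ` A" "s \<in> \<beta> ` A"
  then obtain a b where ab: "a \<in> A" "b \<in> A" "r = \<beta> a" "s = \<beta> b" by auto
  have cl: "a \<in> carrier N" "b \<in> carrier N" using ab A by auto
  show "r\<^bold>+\<^bsub>S\<^esub> \<otimes>\<^bsub>S\<^esub> s = s\<^bold>+\<^bsub>S\<^esub> \<otimes>\<^bsub>S\<^esub> r"
    using arg_cong[OF comp(1)[OF ab(1,2)], of \<beta>] cl ab
    by (simp add: hom_mult hom_plus N.plus_closed)
  show "r \<otimes>\<^bsub>S\<^esub> s\<^bold>*\<^bsub>S\<^esub> = s \<otimes>\<^bsub>S\<^esub> r\<^bold>*\<^bsub>S\<^esub>"
    using arg_cong[OF comp(2)[OF ab(1,2)], of \<beta>] cl ab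
    by (simp add: hom_mult hom_star N.star_closed)
qed

abbreviation "T \<equiv> sigma_quotient N"

definition embed :: "'n \<Rightarrow> 's \<times> 'n set" where
  "embed n = (\<beta> n, sigma N `` {n})"

lemma embed_image: "embed ` carrier N = sub_C S T (hat \<beta>)"
proof
  show "embed ` carrier N \<subseteq> sub_C S T (hat \<beta>)"
    using equiv_class_self[OF N.equiv_sigma]
    by (auto simp: embed_def sub_C_def hat_def N.carrier_sigma_quotient hom_closed intro: quotientI)
  show "sub_C S T (hat \<beta>) \<subseteq> embed ` carrier N"
  proof
    fix p assume "p \<in> sub_C S T (hat \<beta>)"
    then obtain n t where nt: "t \<in> carrier N // sigma N" "n \<in> t" "p = (\<beta> n, t)"
      by (auto simp: sub_C_def hat_def N.carrier_sigma_quotient)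
    then show "p \<in> embed ` carrier N"
      using N.class_obtain[OF nt(1,2)] by (auto simp: embed_def)
  qed
qed

lemma inj_embed: "inj_on embed (carrier N)"
proof (rule inj_onI)
  fix n m assume n: "n \<in> carrier N" and m: "m \<in> carrier N" and eq: "embed n = embed m"
  have "\<beta> (n\<^bold>+\<^bsub>N\<^esub>) = \<beta> (m\<^bold>+\<^bsub>N\<^esub>)" using eq n m by (simp add: embed_def hom_plus)
  then have "n\<^bold>+\<^bsub>N\<^esub> = m\<^bold>+\<^bsub>N\<^esub>"
    using inj_onD[OF inj_projections _ N.plus_in_projections[OF n] N.plus_in_projections[OF m]]
    by simp
  moreover have "(n, m) \<in> sigma N"
    using eq eq_equiv_class[OF _ N.equiv_sigma m] by (simp add: embed_def)
  ultimately show "n = m" using N.proper_plus_eq[OF proper_N, of n m] by simp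
qed

lemma embed_mult:
  "\<lbrakk>n \<in> carrier N; m \<in> carrier N\<rbrakk> \<Longrightarrow> embed (n \<otimes>\<^bsub>N\<^esub> m) = embed n \<otimes>\<^bsub>S \<times>\<^sub>r plain T\<^esub> embed m"
  by (simp add: embed_def rprod_def DirProd_def plain_def hom_mult N.sigma_quotient_mult)

lemma embed_plus:
  "n \<in> carrier N \<Longrightarrow> embed (n\<^bold>+\<^bsub>N\<^esub>) = (embed n)\<^bold>+\<^bsub>S \<times>\<^sub>r plain T\<^esub>"
  using N.sigma_quotient_one[OF N.plus_in_projections, of n]
  by (simp add: embed_def rprod_def plain_def hom_plus)

lemma embed_star:
  "n \<in> carrier N \<Longrightarrow> embed (n\<^bold>*\<^bsub>N\<^esub>) = (embed n)\<^bold>*\<^bsub>S \<times>\<^sub>r plain T\<^esub>"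
  using N.sigma_quotient_one[OF N.star_in_projections, of n]
  by (simp add: embed_def rprod_def plain_def hom_star)

lemma hat_permissible: "hat \<beta> \<in> carrier T \<rightarrow> carrier (\<C> S)"
proof
  fix t assume "t \<in> carrier T"
  then have "permissible S (\<beta> ` t)"
    by (intro permissible_image N.permissible_sigma_class proper_N)
      (simp add: N.carrier_sigma_quotient)
  then show "hat \<beta> t \<in> carrier (\<C> S)" by (simp add: hat_def perm_monoid_def)
qed

lemma sub_C_subsemigroup: "restriction_subsemigroup (sub_C S T (hat \<beta>)) (S \<times>\<^sub>r plain T)"
  unfolding restriction_subsemigroup_def
proof (intro conjI ballI)
  show "sub_C S T (hat \<beta>) \<noteq> {}" using N.nonempty by (simp flip: embed_image)
  show "sub_C S T (hat \<beta>) \<subseteq> carrier (S \<times>\<^sub>r plain T)"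
    by (auto simp: sub_C_def rprod_def plain_def)
  fix p assume "p \<in> sub_C S T (hat \<beta>)"
  then obtain n where n: "n \<in> carrier N" "p = embed n" by (auto simp flip: embed_image)
  show "p\<^bold>+\<^bsub>S \<times>\<^sub>r plain T\<^esub> \<in> sub_C S T (hat \<beta>)"
    unfolding n(2) embed_plus[OF n(1), symmetric] embed_image[symmetric]
    using n(1) by (intro imageI N.plus_closed)
  show "p\<^bold>*\<^bsub>S \<times>\<^sub>r plain T\<^esub> \<in> sub_C S T (hat \<beta>)"
    unfolding n(2) embed_star[OF n(1), symmetric] embed_image[symmetric]
    using n(1) by (intro imageI N.star_closed)
  fix q assume "q \<in> sub_C S T (hat \<beta>)"
  then obtain m where m: "m \<in> carrier N" "q = embed m" by (auto simp flip: embed_image)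
  show "p \<otimes>\<^bsub>S \<times>\<^sub>r plain T\<^esub> q \<in> sub_C S T (hat \<beta>)"
    unfolding n(2) m(2) embed_mult[OF n(1) m(1), symmetric] embed_image[symmetric]
    using n(1) m(1) by (intro imageI N.mult_closed)
qed

lemma riso_sub_C: "N \<cong>\<^sub>r (S \<times>\<^sub>r plain T)\<lparr>carrier := sub_C S T (hat \<beta>)\<rparr>"
  unfolding is_riso_def
proof
  show "embed \<in> rhom N ((S \<times>\<^sub>r plain T)\<lparr>carrier := sub_C S T (hat \<beta>)\<rparr>)"
    unfolding rhom_def hom_def embed_image[symmetric]
    by (simp add: embed_mult embed_plus embed_star)
  show "bij_betw embed (carrier N) (carrier ((S \<times>\<^sub>r plain T)\<lparr>carrier := sub_C S T (hat \<beta>)\<rparr>))"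
    using inj_embed embed_image by (simp add: bij_betw_def)
qed

lemma hat_covers:
  assumes "s \<in> carrier S" shows "\<exists>t \<in> carrier T. s \<in> hat \<beta> t"
proof -
  obtain n where n: "n \<in> carrier N" "s = \<beta> n" using assms surj by auto
  then show ?thesis using equiv_class_self[OF N.equiv_sigma n(1)]
    by (auto simp: hat_def N.carrier_sigma_quotient intro!: bexI[of _ "sigma N `` {n}"] quotientI)
qed

end

locale perfect_cover =
  cover N M \<beta> + N: restriction_monoid N + M: restriction_monoid M
  for N :: "('n, 'x) restr_scheme" and M :: "('m, 'y) restr_scheme" and \<beta> :: "'n \<Rightarrow> 'm" +
  assumes perf: "perfect N" and hom_one: "\<beta> \<one>\<^bsub>N\<^esub> = \<one>\<^bsub>M\<^esub>"
begin

lemma kappa_max: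
  assumes "t \<in> carrier T"
  shows "kappa_max N t \<in> t" "a \<in> t \<Longrightarrow> nat_le N a (kappa_max N t)"
    "kappa_max N t \<in> carrier N" "t = sigma N `` {kappa_max N t}"
proof -
  have t: "t \<in> carrier N // sigma N" using assms by (simp add: N.carrier_sigma_quotient)
  have "is_greatest N t (kappa_max N t)"
    using perf t by (intro N.kappa_max_greatest) (auto simp: perfect_def)
  then show "kappa_max N t \<in> t" "a \<in> t \<Longrightarrow> nat_le N a (kappa_max N t)"
    by (auto simp: is_greatest_def)
  then show "kappa_max N t \<in> carrier N" "t = sigma N `` {kappa_max N t}"
    using N.class_obtain[OF t] by blast+
qed

lemma class_in_carrier: "a \<in> carrier N \<Longrightarrow> sigma N `` {a} \<in> carrier T"
  by (simp add: N.carrier_sigma_quotient quotientI)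

lemma kappa_max_mult:
  assumes t: "t \<in> carrier T" and u: "u \<in> carrier T"
  shows "t \<otimes>\<^bsub>T\<^esub> u \<in> carrier T"
    and "kappa_max N (t \<otimes>\<^bsub>T\<^esub> u) = kappa_max N t \<otimes>\<^bsub>N\<^esub> kappa_max N u"
proof -
  let ?m = "kappa_max N t" and ?k = "kappa_max N u"
  have cl: "?m \<in> carrier N" "?k \<in> carrier N" using kappa_max t u by auto
  have tu: "t \<otimes>\<^bsub>T\<^esub> u = sigma N `` {?m \<otimes>\<^bsub>N\<^esub> ?k}"
    using N.sigma_quotient_mult[OF cl] kappa_max(4)[OF t] kappa_max(4)[OF u] by simp
  show in_T: "t \<otimes>\<^bsub>T\<^esub> u \<in> carrier T"
    unfolding tu by (rule class_in_carrier[OF N.mult_closed[OF cl]])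
  have "sigma N `` {?m} <#>\<^bsub>N\<^esub> sigma N `` {?k} = sigma N `` {?m \<otimes>\<^bsub>N\<^esub> ?k}"
    using perf cl by (simp add: perfect_def almost_perfect_def sigma_perfect_def)
  then have "t <#>\<^bsub>N\<^esub> u = t \<otimes>\<^bsub>T\<^esub> u"
    using tu kappa_max(4)[OF t] kappa_max(4)[OF u] by simp
  then have "kappa_max N (t \<otimes>\<^bsub>T\<^esub> u) \<in> t <#>\<^bsub>N\<^esub> u" using kappa_max(1)[OF in_T] by simp
  then obtain x y where xy: "x \<in> t" "y \<in> u" "kappa_max N (t \<otimes>\<^bsub>T\<^esub> u) = x \<otimes>\<^bsub>N\<^esub> y"
    by (auto simp: set_mult_def)
  show "kappa_max N (t \<otimes>\<^bsub>T\<^esub> u) = ?m \<otimes>\<^bsub>N\<^esub> ?k"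
  proof (rule N.nat_le_antisym)
    show "nat_le N (kappa_max N (t \<otimes>\<^bsub>T\<^esub> u)) (?m \<otimes>\<^bsub>N\<^esub> ?k)"
      using xy kappa_max(2)[OF t] kappa_max(2)[OF u] by (simp add: N.nat_le_mult)
    show "nat_le N (?m \<otimes>\<^bsub>N\<^esub> ?k) (kappa_max N (t \<otimes>\<^bsub>T\<^esub> u))"
      using equiv_class_self[OF N.equiv_sigma N.mult_closed[OF cl]] tu
      by (intro kappa_max(2)[OF in_T]) simp
  qed
qed

lemma kappa_max_one: "kappa_max N (sigma N `` {\<one>\<^bsub>N\<^esub>}) = \<one>\<^bsub>N\<^esub>"
proof -
  let ?m = "kappa_max N (sigma N `` {\<one>\<^bsub>N\<^esub>})"
  have in_T: "sigma N `` {\<one>\<^bsub>N\<^esub>} \<in> carrier T" by (simp add: class_in_carrier)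
  have "nat_le N \<one>\<^bsub>N\<^esub> ?m"
    by (intro kappa_max(2)[OF in_T] equiv_class_self[OF N.equiv_sigma]) simp
  then obtain e where e: "e \<in> projections N" "\<one>\<^bsub>N\<^esub> = e \<otimes>\<^bsub>N\<^esub> ?m" by (auto simp: nat_le_def)
  have cl: "e \<in> carrier N" "?m \<in> carrier N"
    using e kappa_max(3)[OF in_T] by (auto simp: N.projections_closed)
  have "e = e \<otimes>\<^bsub>N\<^esub> (e \<otimes>\<^bsub>N\<^esub> ?m)" using cl by (simp flip: e(2))
  also have "\<dots> = e \<otimes>\<^bsub>N\<^esub> ?m" using e(1) cl by (simp add: N.projection_idem flip: N.assoc)
  finally have "e = \<one>\<^bsub>N\<^esub>" using e(2) by simp
  then show ?thesis using e(2) cl by simp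
qed

abbreviation "\<alpha> \<equiv> \<beta> \<circ> kappa_max N"

lemma alpha_closed: "\<alpha> \<in> carrier T \<rightarrow> carrier M"
  using kappa_max(3) hom_closed by auto

lemma nat_le_alpha_iff:
  assumes "t \<in> carrier T" shows "nat_le M a (\<alpha> t) \<longleftrightarrow> a \<in> hat \<beta> t"
proof
  assume "nat_le M a (\<alpha> t)"
  then obtain n where n: "nat_le N n (kappa_max N t)" "a = \<beta> n"
    using nat_le_lift[of a "kappa_max N t"] kappa_max(3)[OF assms] by auto
  then have "n \<in> t"
    using N.nat_le_sigma[OF n(1)] N.sigma_sym kappa_max(4)[OF assms] by blast
  then show "a \<in> hat \<beta> t" using n by (simp add: hat_def)
next
  assume "a \<in> hat \<beta> t"
  then show "nat_le M a (\<alpha> t)"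
    using hom_nat_le[OF kappa_max(2)[OF assms]] by (auto simp: hat_def)
qed

lemma sub_M_eq: "sub_M M T \<alpha> = sub_C M T (hat \<beta>)"
  unfolding sub_M_def sub_C_def using nat_le_alpha_iff by blast

lemma P_generates_alpha: "P_generates M (\<alpha> ` carrier T)"
  unfolding P_generates_def
proof
  show "submonoid (\<alpha> ` carrier T) M"
  proof
    show "\<alpha> ` carrier T \<subseteq> carrier M" using alpha_closed by auto
    show "\<one>\<^bsub>M\<^esub> \<in> \<alpha> ` carrier T"
      using kappa_max_one hom_one class_in_carrier[of "\<one>\<^bsub>N\<^esub>"]
      by (auto intro!: image_eqI[of _ _ "sigma N `` {\<one>\<^bsub>N\<^esub>}"])
    fix x y assume "x \<in> \<alpha> ` carrier T" "y \<in> \<alpha> ` carrier T"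
    then obtain t u where tu: "t \<in> carrier T" "u \<in> carrier T" "x = \<alpha> t" "y = \<alpha> u" by blast
    then have "x \<otimes>\<^bsub>M\<^esub> y = \<alpha> (t \<otimes>\<^bsub>T\<^esub> u)"
      by (simp add: kappa_max_mult hom_mult kappa_max)
    then show "x \<otimes>\<^bsub>M\<^esub> y \<in> \<alpha> ` carrier T" using kappa_max_mult(1) tu by blast
  qed
  show "carrier M = projections M <#>\<^bsub>M\<^esub> \<alpha> ` carrier T"
  proof
    show "projections M <#>\<^bsub>M\<^esub> \<alpha> ` carrier T \<subseteq> carrier M"
      by (auto simp: set_mult_def S.projections_closed kappa_max(3) hom_closed)
    show "carrier M \<subseteq> projections M <#>\<^bsub>M\<^esub> \<alpha> ` carrier T"
    proof
      fix s assume "s \<in> carrier M"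
      then obtain t where t: "t \<in> carrier T" "nat_le M s (\<alpha> t)"
        using hat_covers nat_le_alpha_iff by blast
      then obtain e where "e \<in> projections M" "s = e \<otimes>\<^bsub>M\<^esub> \<alpha> t" by (auto simp: nat_le_def)
      then show "s \<in> projections M <#>\<^bsub>M\<^esub> \<alpha> ` carrier T"
        using t unfolding set_mult_def by blast
    qed
  qed
qed

end

theorem corollary4p6:
  fixes N :: "('n, 'x) restr_scheme" and S :: "('s, 'y) restr_scheme" and \<beta> :: "'n \<Rightarrow> 's"
    and N' :: "('k, 'u) restr_scheme" and M :: "('m, 'v) restr_scheme" and \<beta>' :: "'k \<Rightarrow> 'm"
  shows
    "(restriction_semigroup S \<and> cover_via N S \<beta> \<and> almost_perfect N \<longrightarrow>
       (let T = sigma_quotient N; \<alpha> = hat \<beta> \<circ> kappa_incl N in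
         \<alpha> \<in> carrier T \<rightarrow> carrier (\<C> S) \<and>
         restriction_subsemigroup (sub_C S T \<alpha>) (S \<times>\<^sub>r plain T) \<and>
         N \<cong>\<^sub>r (S \<times>\<^sub>r plain T)\<lparr>carrier := sub_C S T \<alpha>\<rparr> \<and>
         (\<forall>s \<in> carrier S. \<exists>t \<in> carrier T. s \<in> \<alpha> t)))
     \<and>
     (restriction_monoid M \<and> restriction_monoid N' \<and> perfect N' \<and>
      cover_via N' M \<beta>' \<and> \<beta>' \<one>\<^bsub>N'\<^esub> = \<one>\<^bsub>M\<^esub> \<longrightarrow>
       (let T = sigma_quotient N'; \<alpha> = \<beta>' \<circ> kappa_max N' in
         \<alpha> \<in> carrier T \<rightarrow> carrier M \<and>
         restriction_subsemigroup (sub_M M T \<alpha>) (M \<times>\<^sub>r plain T) \<and>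
         N' \<cong>\<^sub>r (M \<times>\<^sub>r plain T)\<lparr>carrier := sub_M M T \<alpha>\<rparr> \<and>
         P_generates M (\<alpha> ` carrier T)))"
proof (rule conjI; rule impI)
  assume "restriction_semigroup S \<and> cover_via N S \<beta> \<and> almost_perfect N"
  then interpret cover N S \<beta>
    by (auto simp: cover_def cover_axioms_def cover_via_def)
  have "hat \<beta> \<circ> kappa_incl N = hat \<beta>" by (simp add: fun_eq_iff kappa_incl_def)
  then show "let T = sigma_quotient N; \<alpha> = hat \<beta> \<circ> kappa_incl N in
      \<alpha> \<in> carrier T \<rightarrow> carrier (\<C> S) \<and>
      restriction_subsemigroup (sub_C S T \<alpha>) (S \<times>\<^sub>r plain T) \<and>
      N \<cong>\<^sub>r (S \<times>\<^sub>r plain T)\<lparr>carrier := sub_C S T \<alpha>\<rparr> \<and>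
      (\<forall>s \<in> carrier S. \<exists>t \<in> carrier T. s \<in> \<alpha> t)"
    using hat_permissible sub_C_subsemigroup riso_sub_C hat_covers by (simp add: Let_def)
next
  assume "restriction_monoid M \<and> restriction_monoid N' \<and> perfect N' \<and>
    cover_via N' M \<beta>' \<and> \<beta>' \<one>\<^bsub>N'\<^esub> = \<one>\<^bsub>M\<^esub>"
  then interpret perfect_cover N' M \<beta>'
    by (auto simp: perfect_cover_def perfect_cover_axioms_def cover_def cover_axioms_def
        restriction_monoid_def)
  show "let T = sigma_quotient N'; \<alpha> = \<beta>' \<circ> kappa_max N' in
      \<alpha> \<in> carrier T \<rightarrow> carrier M \<and>
      restriction_subsemigroup (sub_M M T \<alpha>) (M \<times>\<^sub>r plain T) \<and>
      N' \<cong>\<^sub>r (M \<times>\<^sub>r plain T)\<lparr>carrier := sub_M M T \<alpha>\<rparr> \<and>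
      P_generates M (\<alpha> ` carrier T)"
    using alpha_closed sub_C_subsemigroup riso_sub_C P_generates_alpha
    unfolding Let_def sub_M_eq by blast
qed

end
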